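(* Let $S$ be a completely simple semigroup and let $e$ be a primitive idempotent of $S$. Set $$L := E(Se), \qquad G := eSe, \qquad R := E(eS).$$ Then the following assertions hold: (i) $LG = Se$ is a left group and $GR = eS$ is a right group. (ii) $RL \subset G$ and $eL = Re = \{e\}$. (iii) $G = Se \cap eS$ is a group whose identity is $e$. (iv) $S = LGR$. (v) The product mapping $\psi : L \times G \times R \to LGR$, $\psi(x,g,y) = xgy$, is bijective, with inverse given by $$\psi^{-1}(z) = \big( ze(eze)^{-1},\ eze,\ (eze)^{-1}ez \big) \in L \times G \times R, \qquad z \in LGR,$$ where $(eze)^{-1}$ is the inverse in the group $G$.
   Context: A semigroup is a non-empty set with an associative multiplication. For subsets $A,B$ of a semigroup, $AB=\{ab: a\in A, b\in B\}$, and an element $a$ is identified with $\{a\}$. For a semigroup $T$, $E(T)=\{x\in T: x^2=x\}$ is its set of idempotents. A left [right] ideal of $S$ is a non-empty $I\subset S$ with $SI\subset I$ [$IS\subset I$]; an ideal is both a left and a right ideal. $S$ is left simple [right simple, simple] if it contains no left ideal [right ideal, ideal] other than $S$ itself. A left group [right group] is a left simple [right simple] semigroup containing at least one idempotent. An idempotent $e\in E(S)$ is primitive if, for $x\in E(S)$, $ex=xe=x$ implies $x=e$. $S$ is completely simple if it is simple and contains a primitive idempotent. *)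

theory Defs
  imports "HOL-Algebra.Coset"
begin

text \<open>
  Semigroups are carried by the \<^type>\<open>monoid_ext\<close> records of HOL-Algebra, so that
  products of subsets are the library's \<^const>\<open>set_mult\<close>, \<^const>\<open>l_coset\<close> and
  \<^const>\<open>r_coset\<close>. Only the fields \<^const>\<open>carrier\<close> and \<^const>\<open>mult\<close> are meaningful:
  nothing below mentions the field \<^const>\<open>one\<close>, which is arbitrary in a semigroup.
  A subset \<open>T\<close> is regarded as a semigroup of its own via \<open>S\<lparr>carrier := T\<rparr>\<close>.
\<close>

locale alg_semigroup =
  fixes S :: "('a, 'b) monoid_scheme" (structure)
  assumes carrier_nonempty: "carrier S \<noteq> {}"
    and m_closed: "\<lbrakk>x \<in> carrier S; y \<in> carrier S\<rbrakk> \<Longrightarrow> x \<otimes> y \<in> carrier S"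
    and m_assoc: "\<lbrakk>x \<in> carrier S; y \<in> carrier S; z \<in> carrier S\<rbrakk>
      \<Longrightarrow> (x \<otimes> y) \<otimes> z = x \<otimes> (y \<otimes> z)"

definition idempotents :: "('a, 'b) monoid_scheme \<Rightarrow> 'a set" where
  "idempotents S = {x \<in> carrier S. x \<otimes>\<^bsub>S\<^esub> x = x}"

definition semigroup_left_ideal :: "'a set \<Rightarrow> ('a, 'b) monoid_scheme \<Rightarrow> bool" where
  "semigroup_left_ideal I S \<longleftrightarrow>
     I \<noteq> {} \<and> I \<subseteq> carrier S \<and> carrier S <#>\<^bsub>S\<^esub> I \<subseteq> I"

definition semigroup_right_ideal :: "'a set \<Rightarrow> ('a, 'b) monoid_scheme \<Rightarrow> bool" where
  "semigroup_right_ideal I S \<longleftrightarrow>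
     I \<noteq> {} \<and> I \<subseteq> carrier S \<and> I <#>\<^bsub>S\<^esub> carrier S \<subseteq> I"

definition semigroup_ideal :: "'a set \<Rightarrow> ('a, 'b) monoid_scheme \<Rightarrow> bool" where
  "semigroup_ideal I S \<longleftrightarrow> semigroup_left_ideal I S \<and> semigroup_right_ideal I S"

definition left_simple :: "('a, 'b) monoid_scheme \<Rightarrow> bool" where
  "left_simple S \<longleftrightarrow>
     alg_semigroup S \<and> (\<forall>I. semigroup_left_ideal I S \<longrightarrow> I = carrier S)"

definition right_simple :: "('a, 'b) monoid_scheme \<Rightarrow> bool" where
  "right_simple S \<longleftrightarrow>
     alg_semigroup S \<and> (\<forall>I. semigroup_right_ideal I S \<longrightarrow> I = carrier S)"

definition simple_semigroup :: "('a, 'b) monoid_scheme \<Rightarrow> bool" where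
  "simple_semigroup S \<longleftrightarrow>
     alg_semigroup S \<and> (\<forall>I. semigroup_ideal I S \<longrightarrow> I = carrier S)"

definition left_group :: "('a, 'b) monoid_scheme \<Rightarrow> bool" where
  "left_group S \<longleftrightarrow> left_simple S \<and> idempotents S \<noteq> {}"

definition right_group :: "('a, 'b) monoid_scheme \<Rightarrow> bool" where
  "right_group S \<longleftrightarrow> right_simple S \<and> idempotents S \<noteq> {}"

definition primitive_idempotent :: "('a, 'b) monoid_scheme \<Rightarrow> 'a \<Rightarrow> bool" where
  "primitive_idempotent S e \<longleftrightarrow> e \<in> idempotents S \<and>
     (\<forall>x \<in> idempotents S. e \<otimes>\<^bsub>S\<^esub> x = x \<and> x \<otimes>\<^bsub>S\<^esub> e = x \<longrightarrow> x = e)"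

definition completely_simple :: "('a, 'b) monoid_scheme \<Rightarrow> bool" where
  "completely_simple S \<longleftrightarrow> simple_semigroup S \<and> (\<exists>e. primitive_idempotent S e)"

end

theory Submission
  imports Defs
begin

text \<open>
  Let \<open>a \<in> eSe\<close>. Simplicity gives \<open>e = x a y\<close> with \<open>x, y \<in> eSe\<close>; then \<open>a y x\<close> and \<open>y x a\<close>
  are idempotents below \<open>e\<close>, so by primitivity both equal \<open>e\<close>, and \<open>eSe\<close> is a group.
  By primitivity again, an idempotent \<open>x \<in> Se\<close> satisfies \<open>e x = e\<close>, and dually \<open>y e = e\<close> for an
  idempotent \<open>y \<in> eS\<close>. Hence \<open>e(x g y)e = g\<close>, which recovers \<open>g\<close> and then \<open>x\<close> and \<open>y\<close>
  from \<open>x g y\<close>. Finally \<open>S = SeS = (Se)(eS) = LGGR = LGR\<close>.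
\<close>

section \<open>Two-sided ideals generated by one element\<close>

context alg_semigroup
begin

text \<open>The set \<open>?I\<close> is SaS. It absorbs multiplication from both sides by
  associativity, so simplicity forces SaS = S. No copy of a has to be adjoined, because being an
  ideal does not require a itself to lie in SaS.\<close>

lemma simple_factorization:
  assumes "simple_semigroup S" "a \<in> carrier S" "z \<in> carrier S"
  obtains s t where "s \<in> carrier S" "t \<in> carrier S" "z = s \<otimes> a \<otimes> t"
proof -
  let ?I = "carrier S #> a <#> carrier S"
  have "semigroup_ideal ?I S"
    unfolding semigroup_ideal_def semigroup_left_ideal_def semigroup_right_ideal_def
  proof (intro conjI)
    show "?I \<noteq> {}" "?I \<noteq> {}"
      using carrier_nonempty by (auto simp: set_mult_def r_coset_def)
    show "?I \<subseteq> carrier S" "?I \<subseteq> carrier S"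
      using assms(2) by (auto simp: set_mult_def r_coset_def intro: m_closed)
    show "carrier S <#> ?I \<subseteq> ?I"
    proof
      fix w assume "w \<in> carrier S <#> ?I"
      then obtain r s t where rst: "r \<in> carrier S" "s \<in> carrier S" "t \<in> carrier S"
        and w: "w = r \<otimes> (s \<otimes> a \<otimes> t)"
        by (auto simp: set_mult_def r_coset_def)
      have "w = r \<otimes> s \<otimes> a \<otimes> t"
        using rst assms(2) w by (simp add: m_assoc m_closed)
      then show "w \<in> ?I"
        using rst m_closed[of r s] by (auto simp: set_mult_def r_coset_def)
    qed
    show "?I <#> carrier S \<subseteq> ?I"
    proof
      fix w assume "w \<in> ?I <#> carrier S"
      then obtain r s t where rst: "r \<in> carrier S" "s \<in> carrier S" "t \<in> carrier S"
        and w: "w = s \<otimes> a \<otimes> t \<otimes> r"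
        by (auto simp: set_mult_def r_coset_def)
      have "w = s \<otimes> a \<otimes> (t \<otimes> r)"
        using rst assms(2) w by (simp add: m_assoc m_closed)
      then show "w \<in> ?I"
        using rst m_closed[of t r] by (auto simp: set_mult_def r_coset_def)
    qed
  qed
  then have "z \<in> ?I"
    using assms(1,3) unfolding simple_semigroup_def by blast
  then obtain s t where "s \<in> carrier S" "t \<in> carrier S" "z = s \<otimes> a \<otimes> t"
    unfolding set_mult_def r_coset_def by blast
  then show thesis by (rule that)
qed

end

section \<open>Membership in Se, eS, G, L and R as equations in S\<close>

locale primitive_simple_semigroup = alg_semigroup S for S (structure) +
  fixes e
  assumes simple: "simple_semigroup S"
    and primitive: "primitive_idempotent S e"
begin

abbreviation "Se \<equiv> carrier S #> e"
abbreviation "eS \<equiv> e <# carrier S"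
abbreviation "G \<equiv> e <# carrier S #> e"
abbreviation "L \<equiv> idempotents (S\<lparr>carrier := Se\<rparr>)"
abbreviation "R \<equiv> idempotents (S\<lparr>carrier := eS\<rparr>)"
text \<open>The field \<open>one\<close> of S is arbitrary, so it is replaced by e; only then do
  \<open>group\<close> and \<open>inv\<close> refer to the identity of eSe.\<close>

abbreviation "GG \<equiv> S\<lparr>carrier := G, one := e\<rparr>"

lemma e_closed: "e \<in> carrier S" and e_idem: "e \<otimes> e = e"
  using primitive by (auto simp: primitive_idempotent_def idempotents_def)

text \<open>Once \<open>m_assoc\<close> has moved all parentheses to the right, ee no longer occurs
  as a subterm of a longer product, so \<open>e_idem\<close> alone could not contract it. The set
  \<open>normalize\<close> relies on this form.\<close>

lemma e_absorb: "x \<in> carrier S \<Longrightarrow> e \<otimes> (e \<otimes> x) = e \<otimes> x"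
  using m_assoc[of e e x] by (simp add: e_closed e_idem)

lemmas normalize = m_assoc m_closed e_closed e_idem e_absorb

lemma primitiveD:
  "\<lbrakk>f \<in> carrier S; f \<otimes> f = f; e \<otimes> f = f; f \<otimes> e = f\<rbrakk> \<Longrightarrow> f = e"
  using primitive by (auto simp: primitive_idempotent_def idempotents_def)

text \<open>Since e is idempotent, the multiples se are exactly the fixed points of right
  multiplication by e. This and the next characterizations turn questions about sets into
  equations.\<close>

lemma mem_Se: "x \<in> Se \<longleftrightarrow> x \<in> carrier S \<and> x \<otimes> e = x"
  by (auto simp: r_coset_def normalize) metis

lemma mem_eS: "x \<in> eS \<longleftrightarrow> x \<in> carrier S \<and> e \<otimes> x = x"
  by (auto simp: l_coset_def normalize) metis

lemma Se_nonempty: "Se \<noteq> {}" and eS_nonempty: "eS \<noteq> {}"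
  using carrier_nonempty by (auto simp: r_coset_def l_coset_def)

lemma mem_G: "x \<in> G \<longleftrightarrow> x \<in> carrier S \<and> e \<otimes> x = x \<and> x \<otimes> e = x"
proof
  assume "x \<in> G"
  then show "x \<in> carrier S \<and> e \<otimes> x = x \<and> x \<otimes> e = x"
    by (auto simp: r_coset_def l_coset_def normalize)
next
  assume x: "x \<in> carrier S \<and> e \<otimes> x = x \<and> x \<otimes> e = x"
  then have "x = e \<otimes> x \<otimes> e" by simp
  with x show "x \<in> G" unfolding r_coset_def l_coset_def by blast
qed

text \<open>This is where primitivity shapes L: if xx = x and xe = x, then x(ex) = (xe)x = x, so ex
  is an idempotent with e(ex) = ex = (ex)e and hence equals e. Conversely, xx = (xe)x = x(ex) = xe =
  x.\<close>

lemma mem_L: "x \<in> L \<longleftrightarrow> x \<in> carrier S \<and> x \<otimes> e = x \<and> e \<otimes> x = e"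
proof
  assume "x \<in> L"
  then have x: "x \<in> carrier S" "x \<otimes> e = x" "x \<otimes> x = x"
    by (auto simp: idempotents_def mem_Se)
  have "x \<otimes> (e \<otimes> x) = x"
    using m_assoc[of x e x] x e_closed by simp
  then have "e \<otimes> x = e"
    using x by (intro primitiveD) (simp_all add: normalize)
  with x show "x \<in> carrier S \<and> x \<otimes> e = x \<and> e \<otimes> x = e" by simp
next
  assume "x \<in> carrier S \<and> x \<otimes> e = x \<and> e \<otimes> x = e"
  then show "x \<in> L"
    using m_assoc[of x e x] e_closed by (auto simp: idempotents_def mem_Se)
qed

text \<open>Dual to \<open>mem_L\<close>: here ye is the idempotent below e, since (ye)(ye) = y(ey)e
  = (yy)e = ye.\<close>

lemma mem_R: "y \<in> R \<longleftrightarrow> y \<in> carrier S \<and> e \<otimes> y = y \<and> y \<otimes> e = e"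
proof
  assume "y \<in> R"
  then have y: "y \<in> carrier S" "e \<otimes> y = y" "y \<otimes> y = y"
    by (auto simp: idempotents_def mem_eS)
  have "y \<otimes> (e \<otimes> (y \<otimes> e)) = y \<otimes> e"
    using m_assoc[of y y e] m_assoc[of e y e] y e_closed by simp
  then have "y \<otimes> e = e"
    using y m_assoc[of e y e] by (intro primitiveD) (simp_all add: normalize)
  with y show "y \<in> carrier S \<and> e \<otimes> y = y \<and> y \<otimes> e = e" by simp
next
  assume "y \<in> carrier S \<and> e \<otimes> y = y \<and> y \<otimes> e = e"
  then show "y \<in> R"
    using m_assoc[of y e y] e_closed by (auto simp: idempotents_def mem_eS)
qed

lemma e_mem_L: "e \<in> L" and e_mem_R: "e \<in> R"
  by (simp_all add: mem_L mem_R e_closed e_idem)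

section \<open>The group eSe\<close>

lemma local_inverse:
  assumes "a \<in> G"
  obtains b where "b \<in> G" "b \<otimes> a = e" "a \<otimes> b = e"
proof -
  have a: "a \<in> carrier S" "e \<otimes> a = a" "a \<otimes> e = a"
    using assms by (auto simp: mem_G)
  obtain u v where uv: "u \<in> carrier S" "v \<in> carrier S" "e = u \<otimes> a \<otimes> v"
    using simple_factorization[OF simple a(1) e_closed] .
  \<comment> \<open>Because a = eae, the outer factors can be compressed into eSe: (eue)a(eve) =
    e(uav)e = e.\<close>
  define x where "x = e \<otimes> u \<otimes> e"
  define y where "y = e \<otimes> v \<otimes> e"
  have x: "x \<in> carrier S" "e \<otimes> x = x" "x \<otimes> e = x"
    and y: "y \<in> carrier S" "e \<otimes> y = y" "y \<otimes> e = y"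
    using uv(1,2) by (simp_all add: x_def y_def normalize)
  have ae: "e \<otimes> (a \<otimes> t) = a \<otimes> t" "a \<otimes> (e \<otimes> t) = a \<otimes> t" if "t \<in> carrier S" for t
    using m_assoc[of e a t] m_assoc[of a e t] a e_closed that by simp_all
  have "x \<otimes> a \<otimes> y = e \<otimes> (u \<otimes> a \<otimes> v) \<otimes> e"
    using uv(1,2) a(1) by (simp add: x_def y_def normalize ae)
  also have "\<dots> = e"
    by (simp add: uv(3)[symmetric] e_idem)
  finally have xay: "x \<otimes> a \<otimes> y = e" .
  \<comment> \<open>The factors are swapped so that xay = e appears in the middle of bab, which
    gives bab = yex = b. Hence ba and ab are both idempotents below e.\<close>
  define b where "b = y \<otimes> x"
  have b: "b \<in> G"
    using x y m_assoc[of e y x] by (simp add: b_def mem_G normalize)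
  then have b': "b \<in> carrier S" "e \<otimes> b = b" "b \<otimes> e = b" by (auto simp: mem_G)
  have bab: "b \<otimes> a \<otimes> b = b"
  proof -
    have "b \<otimes> a \<otimes> b = y \<otimes> (x \<otimes> a \<otimes> y) \<otimes> x"
      using a x y by (simp add: b_def m_assoc m_closed)
    then show ?thesis by (simp add: xay b_def y)
  qed
  have "b \<otimes> a = e"
  proof (rule primitiveD)
    show "b \<otimes> a \<otimes> (b \<otimes> a) = b \<otimes> a"
      using bab a b' m_assoc[of "b \<otimes> a" b a] by (simp add: m_closed)
  qed (use a b' m_assoc[of e b a] in \<open>simp_all add: normalize\<close>)
  moreover have "a \<otimes> b = e"
  proof (rule primitiveD)
    show "a \<otimes> b \<otimes> (a \<otimes> b) = a \<otimes> b"
      using bab a b' by (simp add: normalize)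
  qed (use a b' m_assoc[of e a b] in \<open>simp_all add: normalize\<close>)
  ultimately show thesis using b that by blast
qed

lemma group_GG: "group GG"
proof (rule groupI)
  fix x assume "x \<in> carrier GG"
  then obtain b where "b \<in> G" "b \<otimes> x = e"
    using local_inverse[of x] by auto
  then show "\<exists>b\<in>carrier GG. b \<otimes>\<^bsub>GG\<^esub> x = \<one>\<^bsub>GG\<^esub>"
    by auto
next
  fix x y assume "x \<in> carrier GG" "y \<in> carrier GG"
  then show "x \<otimes>\<^bsub>GG\<^esub> y \<in> carrier GG"
    using m_assoc[of e x y] by (simp add: mem_G normalize)
qed (auto simp: mem_G normalize)

text \<open>Inverses in G satisfy these equations in S itself, so later calculations can mix them
  with elements outside G.\<close>

lemma inv_GG:
  assumes "h \<in> G"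
  shows "inv\<^bsub>GG\<^esub> h \<in> carrier S" "e \<otimes> inv\<^bsub>GG\<^esub> h = inv\<^bsub>GG\<^esub> h" "inv\<^bsub>GG\<^esub> h \<otimes> e = inv\<^bsub>GG\<^esub> h"
    "inv\<^bsub>GG\<^esub> h \<otimes> h = e" "h \<otimes> inv\<^bsub>GG\<^esub> h = e"
  using group.inv_closed[OF group_GG, of h] group.l_inv[OF group_GG, of h]
    group.r_inv[OF group_GG, of h] assms
  by (auto simp: mem_G)

lemma sandwich_G: "z \<in> carrier S \<Longrightarrow> e \<otimes> z \<otimes> e \<in> G"
  by (simp add: mem_G normalize)

section \<open>The factorizations Se = LG and eS = GR\<close>

lemma left_factor_L:
  assumes "z \<in> carrier S"
  shows "z \<otimes> e \<otimes> inv\<^bsub>GG\<^esub> (e \<otimes> z \<otimes> e) \<in> L"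
proof -
  note h = inv_GG[OF sandwich_G[OF assms]]
  \<comment> \<open>Regrouping exposes h = eze next to its inverse, so left multiplication by e
    yields e, as \<open>mem_L\<close> requires.\<close>
  have "e \<otimes> (z \<otimes> e \<otimes> inv\<^bsub>GG\<^esub> (e \<otimes> z \<otimes> e)) = e \<otimes> z \<otimes> e \<otimes> inv\<^bsub>GG\<^esub> (e \<otimes> z \<otimes> e)"
    using assms h(1) m_closed e_closed m_assoc by metis
  then show ?thesis
    using assms h by (simp add: mem_L normalize)
qed

lemma right_factor_R:
  assumes "z \<in> carrier S"
  shows "inv\<^bsub>GG\<^esub> (e \<otimes> z \<otimes> e) \<otimes> e \<otimes> z \<in> R"
proof -
  note h = inv_GG[OF sandwich_G[OF assms]]
  have "inv\<^bsub>GG\<^esub> (e \<otimes> z \<otimes> e) \<otimes> e \<otimes> z \<otimes> e = inv\<^bsub>GG\<^esub> (e \<otimes> z \<otimes> e) \<otimes> (e \<otimes> z \<otimes> e)"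
    using assms h(1) by (simp add: normalize)
  then show ?thesis
    using assms h m_assoc[of e "inv\<^bsub>GG\<^esub> (e \<otimes> z \<otimes> e)" z] by (simp add: mem_R m_closed e_closed)
qed

lemma L_mult_G: "L <#> G = Se"
proof (rule equalityI; rule subsetI)
  fix z assume "z \<in> L <#> G"
  then show "z \<in> Se"
    by (auto simp: set_mult_def mem_L mem_G mem_Se normalize)
next
  fix z assume "z \<in> Se"
  then have z: "z \<in> carrier S" "z \<otimes> e = z" by (auto simp: mem_Se)
  note h = inv_GG[OF sandwich_G[OF z(1)]]
  \<comment> \<open>With h = eze, the factors are (z e h^-1) in L and h in G; their product is
    z(h^-1 h) = ze = z.\<close>
  have "z \<otimes> e \<otimes> inv\<^bsub>GG\<^esub> (e \<otimes> z \<otimes> e) \<otimes> (e \<otimes> z \<otimes> e)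
      = z \<otimes> (inv\<^bsub>GG\<^esub> (e \<otimes> z \<otimes> e) \<otimes> (e \<otimes> z \<otimes> e))"
    using z h(1) m_assoc e_closed m_closed by metis
  also have "\<dots> = z" using z by (simp only: h)
  finally show "z \<in> L <#> G"
    using left_factor_L[OF z(1)] sandwich_G[OF z(1)] unfolding set_mult_def by force
qed

lemma G_mult_R: "G <#> R = eS"
proof (rule equalityI; rule subsetI)
  fix z assume "z \<in> G <#> R"
  then obtain g y where "g \<in> carrier S" "e \<otimes> g = g" "y \<in> carrier S" "z = g \<otimes> y"
    by (auto simp: set_mult_def mem_R mem_G)
  then show "z \<in> eS"
    using m_assoc[of e g y] e_closed by (simp add: mem_eS m_closed)
next
  fix z assume "z \<in> eS"
  then have z: "z \<in> carrier S" "e \<otimes> z = z" by (auto simp: mem_eS)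
  note h = inv_GG[OF sandwich_G[OF z(1)]]
  have "e \<otimes> z \<otimes> e \<otimes> (inv\<^bsub>GG\<^esub> (e \<otimes> z \<otimes> e) \<otimes> e \<otimes> z)
      = e \<otimes> z \<otimes> e \<otimes> inv\<^bsub>GG\<^esub> (e \<otimes> z \<otimes> e) \<otimes> z"
    using z h(1,3) m_assoc[of "e \<otimes> z \<otimes> e"] e_closed by (simp add: m_closed)
  also have "\<dots> = z" unfolding h(5) by (rule z(2))
  finally show "z \<in> G <#> R"
    using right_factor_R[OF z(1)] sandwich_G[OF z(1)] unfolding set_mult_def by force
qed

section \<open>Left simplicity of Se and right simplicity of eS\<close>

lemma left_group_Se: "left_group (S\<lparr>carrier := Se\<rparr>)"
  unfolding left_group_def left_simple_def
proof (intro conjI allI impI)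
  show "alg_semigroup (S\<lparr>carrier := Se\<rparr>)"
    by unfold_locales (simp_all add: Se_nonempty mem_Se normalize)
  show "idempotents (S\<lparr>carrier := Se\<rparr>) \<noteq> {}"
    using e_mem_L by blast
next
  fix I assume "semigroup_left_ideal I (S\<lparr>carrier := Se\<rparr>)"
  then have I: "I \<noteq> {}" "I \<subseteq> Se" "\<And>s a. s \<in> Se \<Longrightarrow> a \<in> I \<Longrightarrow> s \<otimes> a \<in> I"
    by (auto simp: semigroup_left_ideal_def set_mult_def)
  from I(1,2) obtain a where "a \<in> I" "a \<in> Se" by blast
  then have a: "a \<in> I" "a \<in> carrier S" "a \<otimes> e = a" by (simp_all add: mem_Se)
  then have ea: "e \<otimes> a \<in> G" by (simp add: mem_G normalize)
  note h = inv_GG[OF ea]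
  \<comment> \<open>An element a of Se need not lie in G, but ea does, and (ea)^-1 absorbs e on its
    right. Thus (ea)^-1 a = e, which puts e into the ideal; then s = se is in it for every s in
    Se.\<close>
  have "inv\<^bsub>GG\<^esub> (e \<otimes> a) \<otimes> a = inv\<^bsub>GG\<^esub> (e \<otimes> a) \<otimes> (e \<otimes> a)"
    using m_assoc[of "inv\<^bsub>GG\<^esub> (e \<otimes> a)" e a] h(1,3) a e_closed by simp
  then have "e \<in> I"
    using I(3)[of "inv\<^bsub>GG\<^esub> (e \<otimes> a)" a] a h by (simp add: mem_Se)
  then have "s \<in> I" if "s \<in> Se" for s
    using I(3)[of s e] that by (simp add: mem_Se)
  with I(2) show "I = carrier (S\<lparr>carrier := Se\<rparr>)" by auto
qed

lemma right_group_eS: "right_group (S\<lparr>carrier := eS\<rparr>)"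
  unfolding right_group_def right_simple_def
proof (intro conjI allI impI)
  show "alg_semigroup (S\<lparr>carrier := eS\<rparr>)"
  proof
    fix x y assume "x \<in> carrier (S\<lparr>carrier := eS\<rparr>)" "y \<in> carrier (S\<lparr>carrier := eS\<rparr>)"
    then show "x \<otimes>\<^bsub>S\<lparr>carrier := eS\<rparr>\<^esub> y \<in> carrier (S\<lparr>carrier := eS\<rparr>)"
      using m_assoc[of e x y] e_closed by (simp add: mem_eS m_closed)
  qed (simp_all add: eS_nonempty mem_eS normalize)
  show "idempotents (S\<lparr>carrier := eS\<rparr>) \<noteq> {}"
    using e_mem_R by blast
next
  fix I assume "semigroup_right_ideal I (S\<lparr>carrier := eS\<rparr>)"
  then have I: "I \<noteq> {}" "I \<subseteq> eS" "\<And>s a. s \<in> eS \<Longrightarrow> a \<in> I \<Longrightarrow> a \<otimes> s \<in> I"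
    by (auto simp: semigroup_right_ideal_def set_mult_def)
  from I(1,2) obtain a where "a \<in> I" "a \<in> eS" by blast
  then have a: "a \<in> I" "a \<in> carrier S" "e \<otimes> a = a" by (simp_all add: mem_eS)
  then have ae: "a \<otimes> e \<in> G"
    using m_assoc[of e a e] by (simp add: mem_G normalize)
  note h = inv_GG[OF ae]
  have "a \<otimes> inv\<^bsub>GG\<^esub> (a \<otimes> e) = a \<otimes> e \<otimes> inv\<^bsub>GG\<^esub> (a \<otimes> e)"
    using m_assoc[of a e "inv\<^bsub>GG\<^esub> (a \<otimes> e)"] h(1,2) a e_closed by simp
  then have "e \<in> I"
    using I(3)[of "inv\<^bsub>GG\<^esub> (a \<otimes> e)" a] a h by (simp add: mem_eS)
  then have "s \<in> I" if "s \<in> eS" for s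
    using I(3)[of s e] that by (simp add: mem_eS)
  with I(2) show "I = carrier (S\<lparr>carrier := eS\<rparr>)" by auto
qed

section \<open>Products of R, L and e, and the decomposition S = LGR\<close>

lemma R_mult_L: "R <#> L \<subseteq> G"
proof
  fix z assume "z \<in> R <#> L"
  then obtain y x where "y \<in> carrier S" "e \<otimes> y = y" "x \<in> carrier S" "x \<otimes> e = x" "z = y \<otimes> x"
    by (auto simp: set_mult_def mem_R mem_L)
  then show "z \<in> G"
    using m_assoc[of e y x] by (simp add: mem_G normalize)
qed

lemma e_mult_L: "e <# L = {e}"
  using e_mem_L by (auto simp: l_coset_def mem_L)

lemma R_mult_e: "R #> e = {e}"
  using e_mem_R by (auto simp: r_coset_def mem_R)

lemma carrier_eq_LGR: "carrier S = L <#> G <#> R"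
proof (rule equalityI; rule subsetI)
  fix z assume "z \<in> carrier S"
  then obtain s t where st: "s \<in> carrier S" "t \<in> carrier S" "z = s \<otimes> e \<otimes> t"
    using simple_factorization[OF simple e_closed] by metis
  have "e \<otimes> t \<in> G <#> R"
    using st by (simp add: G_mult_R mem_eS normalize)
  then obtain g y where gy: "g \<in> G" "y \<in> R" "e \<otimes> t = g \<otimes> y"
    by (auto simp: set_mult_def)
  \<comment> \<open>The group factor g, split off from et, is passed to the left: ge = g puts sg
    into Se = LG. So the two factorizations share a single group factor.\<close>
  have "s \<otimes> g \<in> L <#> G"
    using st gy by (simp add: L_mult_G mem_Se mem_G normalize)
  moreover have "z = s \<otimes> g \<otimes> y"
    using st gy by (simp add: mem_G mem_R m_assoc e_closed)
  ultimately show "z \<in> L <#> G <#> R"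
    using gy(2) unfolding set_mult_def[of S "L <#> G" R] by auto
next
  fix z assume "z \<in> L <#> G <#> R"
  then show "z \<in> carrier S"
    by (auto simp: set_mult_def mem_L mem_G mem_R m_closed)
qed

section \<open>Coordinates of a product xgy, and the bijection\<close>

lemma
  assumes x: "x \<in> L" and g: "g \<in> G" and y: "y \<in> R"
  shows LGR_middle: "e \<otimes> (x \<otimes> g \<otimes> y) \<otimes> e = g"
    and LGR_left: "x \<otimes> g \<otimes> y \<otimes> e \<otimes> inv\<^bsub>GG\<^esub> g = x"
    and LGR_right: "inv\<^bsub>GG\<^esub> g \<otimes> e \<otimes> (x \<otimes> g \<otimes> y) = y"
proof -
  have carr: "x \<in> carrier S" "g \<in> carrier S" "y \<in> carrier S"
    and x': "x \<otimes> e = x" "e \<otimes> x = e" and g': "e \<otimes> g = g" "g \<otimes> e = g"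
    and y': "e \<otimes> y = y" "y \<otimes> e = e"
    using x g y by (auto simp: mem_L mem_G mem_R)
  note h = inv_GG[OF g]
  \<comment> \<open>Multiplying by e on the right erases y, since ye = e; on the left it erases x,
    since ex = e. Cancelling g from xg or gy then isolates the remaining factor.\<close>
  have zr: "x \<otimes> g \<otimes> y \<otimes> e = x \<otimes> g"
    using carr by (simp add: normalize y' g')
  have zl: "e \<otimes> (x \<otimes> g \<otimes> y) = g \<otimes> y"
    using carr e_closed m_closed m_assoc g'(1) x'(2) by metis
  show "e \<otimes> (x \<otimes> g \<otimes> y) \<otimes> e = g"
    unfolding zl using carr by (simp add: m_assoc e_closed y' g')
  show "x \<otimes> g \<otimes> y \<otimes> e \<otimes> inv\<^bsub>GG\<^esub> g = x"
    unfolding zr using carr h by (simp add: m_assoc x')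
  show "inv\<^bsub>GG\<^esub> g \<otimes> e \<otimes> (x \<otimes> g \<otimes> y) = y"
    using carr h m_assoc[of "inv\<^bsub>GG\<^esub> g" g y] m_assoc[of "inv\<^bsub>GG\<^esub> g" e "x \<otimes> g \<otimes> y"]
    by (simp add: zl m_closed e_closed y')
qed

definition product_map :: "'a \<times> 'a \<times> 'a \<Rightarrow> 'a" where
  "product_map = (\<lambda>(x, g, y). x \<otimes> g \<otimes> y)"

definition factor_map :: "'a \<Rightarrow> 'a \<times> 'a \<times> 'a" where
  "factor_map z = (z \<otimes> e \<otimes> inv\<^bsub>GG\<^esub> (e \<otimes> z \<otimes> e),
     e \<otimes> z \<otimes> e,
     inv\<^bsub>GG\<^esub> (e \<otimes> z \<otimes> e) \<otimes> e \<otimes> z)"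

lemma factor_product: "p \<in> L \<times> G \<times> R \<Longrightarrow> factor_map (product_map p) = p"
  by (auto simp: factor_map_def product_map_def LGR_middle LGR_left LGR_right)

lemma factor_map_closed:
  assumes "z \<in> L <#> G <#> R"
  shows "factor_map z \<in> L \<times> G \<times> R"
proof -
  have "z \<in> carrier S" using assms carrier_eq_LGR by blast
  then show ?thesis
    by (simp add: factor_map_def left_factor_L right_factor_R sandwich_G)
qed

text \<open>A left inverse suffices here: surjectivity onto LGR holds by the definition of set
  products, so the other composite need not be computed.\<close>

lemma inj_on_product_map: "inj_on product_map (L \<times> G \<times> R)"
  by (rule inj_on_inverseI[where g = factor_map]) (rule factor_product)

lemma image_product_map: "product_map ` (L \<times> G \<times> R) = L <#> G <#> R"
  by (force simp: product_map_def set_mult_def)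

lemma bij_betw_product_map: "bij_betw product_map (L \<times> G \<times> R) (L <#> G <#> R)"
  by (simp only: bij_betw_def inj_on_product_map image_product_map simp_thms)

text \<open>\<open>inv_into\<close> chooses some preimage. Injectivity makes it the given p, and
  \<open>factor_map\<close> recovers the same p.\<close>

lemma inv_into_product_map:
  assumes "z \<in> L <#> G <#> R"
  shows "inv_into (L \<times> G \<times> R) product_map z = factor_map z"
proof -
  obtain p where "p \<in> L \<times> G \<times> R" "z = product_map p"
    using assms image_product_map by blast
  then show ?thesis
    by (simp only: factor_product inv_into_f_f[OF inj_on_product_map])
qed

end

theorem theorem2p8:
  fixes S :: "('a, 'b) monoid_scheme" (structure)
    and e :: 'a
    and Se eS L G R :: "'a set"
    and GG :: "('a, 'b) monoid_scheme"
    and \<psi> :: "'a \<times> 'a \<times> 'a \<Rightarrow> 'a"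
  assumes "completely_simple S"
    and "primitive_idempotent S e"
    and "Se = carrier S #> e"
    and "eS = e <# carrier S"
    and "L = idempotents (S\<lparr>carrier := Se\<rparr>)"
    and "G = e <# carrier S #> e"
    and "R = idempotents (S\<lparr>carrier := eS\<rparr>)"
    and "GG = S\<lparr>carrier := G, one := e\<rparr>"
    and "\<psi> = (\<lambda>(x, g, y). x \<otimes> g \<otimes> y)"
  shows
    "(L <#> G = Se \<and> left_group (S\<lparr>carrier := Se\<rparr>) \<and>
      G <#> R = eS \<and> right_group (S\<lparr>carrier := eS\<rparr>)) \<and>
     (R <#> L \<subseteq> G \<and> e <# L = {e} \<and> R #> e = {e}) \<and>
     (G = Se \<inter> eS \<and> group GG) \<and>
     carrier S = L <#> G <#> R \<and>
     (bij_betw \<psi> (L \<times> G \<times> R) (L <#> G <#> R) \<and>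
      (\<forall>z \<in> L <#> G <#> R.
         (z \<otimes> e \<otimes> inv\<^bsub>GG\<^esub> (e \<otimes> z \<otimes> e),
          e \<otimes> z \<otimes> e,
          inv\<^bsub>GG\<^esub> (e \<otimes> z \<otimes> e) \<otimes> e \<otimes> z) \<in> L \<times> G \<times> R \<and>
         inv_into (L \<times> G \<times> R) \<psi> z =
           (z \<otimes> e \<otimes> inv\<^bsub>GG\<^esub> (e \<otimes> z \<otimes> e),
            e \<otimes> z \<otimes> e,
            inv\<^bsub>GG\<^esub> (e \<otimes> z \<otimes> e) \<otimes> e \<otimes> z)))"
proof -
  interpret alg_semigroup S
    using assms(1) by (simp add: completely_simple_def simple_semigroup_def)
  interpret P: primitive_simple_semigroup S e
    using assms(1,2) by unfold_locales (auto simp: completely_simple_def)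
  have G_eq: "P.G = P.Se \<inter> P.eS"
    by (auto simp: P.mem_G P.mem_Se P.mem_eS)
  have \<psi>_eq: "\<psi> = P.product_map"
    unfolding assms(9) P.product_map_def ..
  show ?thesis
    unfolding assms(3-8) \<psi>_eq
    by (intro conjI ballI P.L_mult_G P.left_group_Se P.G_mult_R P.right_group_eS
        P.R_mult_L P.e_mult_L P.R_mult_e G_eq P.group_GG P.carrier_eq_LGR P.bij_betw_product_map
        P.factor_map_closed[unfolded P.factor_map_def]
        P.inv_into_product_map[unfolded P.factor_map_def])
qed

end
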